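(* Let $w^H$ be the weight system of height $3$ on the lecture hall graph defined, for $0\le j\le i$, by \[ w^H(t;i,j)=\begin{cases}(q^j+q^{-j})/2 & \text{if } t=0,\\ -q^{j-i}/2 & \text{if } t=1,\\ -q^{i-j}/2 & \text{if } t=2,\end{cases} \] (and $w^H(t;i,j)=0$ for $t\ge3$). Then the mixed moments $\sigma^H_{n,k}(q)$ of the continuous $q$-Hermite polynomials satisfy \[ \sigma^H_{n,k}(q)=h^{w^H}_{n,k}\qquad(n\ge k\ge0). \]
   Context: Lecture hall graph. For integers $t\ge0$, $0\le j\le i$ put $v^t_{i,j}=(i,\,t+\frac{j}{i+1})$, and set $v^t_{i,i+1}:=v^{t+1}_{i,0}$. The vertices of the lecture hall graph are all $v^t_{i,j}$; its edges join $v^t_{i,j}$ with $v^t_{i,j+1}$ (vertical edges) and $v^t_{i,j}$ with $v^t_{i+1,j}$, for $t\ge 0$, $0\le j\le i$. An east step is a directed edge $(v^t_{i,j},v^t_{i+1,j})$; a south step is a vertical edge directed downwards, $(v^t_{i,j+1},v^t_{i,j})$. A weight system $w$ assigns a weight $w(t;i,j)$ to each east step $(v^t_{i,j},v^t_{i+1,j})$; its height is the smallest integer $\ell$ with $w(t;i,j)=0$ for all $t\ge\ell$. The weight $w(p)$ of a path is the product of the weights of its east steps. $\mathrm{SE}((k,\infty)\to(n,0))$ is the set of paths $(\dots,v_2,v_1,v_0)$ with $v_0=(n,0)$, $\lim_{m\to\infty}v_m=(k,\infty)$, and each $(v_{m+1},v_m)$ a south or east step. Define $h^w_{n,k}=\sum_{p\in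 \mathrm{SE}((k,\infty)\to(n,0))}w(p)$ (so $h^w_{n,n}=1$). Continuous $q$-Hermite polynomials. With $x=\cos\theta$ and $\mathbf i=\sqrt{-1}$, the monic continuous $q$-Hermite polynomials are $H_n(x|q)=\frac{e^{\mathbf in\theta}}{2^n}\,{}_2\phi_0\!\left(\begin{matrix}q^{-n},0\\-\end{matrix};q,q^ne^{-2\mathbf i\theta}\right)$, where ${}_2\phi_0(\alpha_1,\alpha_2;-;q,z)=\sum_{k\ge0}\frac{(\alpha_1;q)_k(\alpha_2;q)_k}{(q;q)_k}\big((-1)^kq^{\binom k2}\big)^{-1}z^k$ and $(z;q)_k=\prod_{i=0}^{k-1}(1-zq^i)$. The mixed moments are defined by $x^n=\sum_{k=0}^n\sigma^H_{n,k}(q)H_k(x|q)$. Here $q$ is an indeterminate. *)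

theory Defs
  imports Complex_Main "HOL-Computational_Algebra.Computational_Algebra"
begin

section \<open>The lecture hall graph\<close>

type_synonym point = "real \<times> real"

text \<open>With \<open>j = i + 1\<close> the formula gives \<open>lh_vertex (t + 1) i 0\<close>, which is the convention
  for \<open>v\<^sup>t\<^bsub>i,i+1\<^esub>\<close>.\<close>

definition lh_vertex :: "nat \<Rightarrow> nat \<Rightarrow> nat \<Rightarrow> point" where
  "lh_vertex t i j = (real i, real t + real j / (real i + 1))"

definition east_step :: "point \<Rightarrow> point \<Rightarrow> bool" where
  "east_step u v \<longleftrightarrow>
     (\<exists>t i j. j \<le> i \<and> u = lh_vertex t i j \<and> v = lh_vertex t (i + 1) j)"

definition south_step :: "point \<Rightarrow> point \<Rightarrow> bool" where
  "south_step u v \<longleftrightarrow>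
     (\<exists>t i j. j \<le> i \<and> u = lh_vertex t i (j + 1) \<and> v = lh_vertex t i j)"

text \<open>A path \<open>(\<dots>, v\<^sub>2, v\<^sub>1, v\<^sub>0)\<close> is indexed backwards from its end point:
  \<open>p m\<close> is \<open>v\<^sub>m\<close>.\<close>

definition SE :: "nat \<Rightarrow> nat \<Rightarrow> (nat \<Rightarrow> point) set" where
  "SE k n = {p. p 0 = (real n, 0) \<and>
     (\<forall>m. south_step (p (Suc m)) (p m) \<or> east_step (p (Suc m)) (p m)) \<and>
     (\<lambda>m. fst (p m)) \<longlonglongrightarrow> real k \<and> filterlim (\<lambda>m. snd (p m)) at_top sequentially}"

text \<open>Only the values \<open>w t i j\<close> with \<open>j \<le> i\<close> are weights of east steps; the other
  values of the function are never used.\<close>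

type_synonym 'a weight_system = "nat \<Rightarrow> nat \<Rightarrow> nat \<Rightarrow> 'a"

definition height :: "'a::zero weight_system \<Rightarrow> nat" where
  "height w = (LEAST l. \<forall>t\<ge>l. \<forall>i. \<forall>j\<le>i. w t i j = 0)"

text \<open>The index set consists of the positions \<open>m\<close> at which \<open>p\<close> makes an east step, each
  together with the (unique) labels \<open>t, i, j\<close> of that step. For \<open>p \<in> SE k n\<close> it
  is finite with \<open>n - k\<close> elements.\<close>

definition path_weight :: "'a::comm_semiring_1 weight_system \<Rightarrow> (nat \<Rightarrow> point) \<Rightarrow> 'a" where
  "path_weight w p =
     (\<Prod>(m, t, i, j) \<in> {(m, t, i, j). j \<le> i \<and>
        p (Suc m) = lh_vertex t i j \<and> p m = lh_vertex t (i + 1) j}. w t i j)"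

text \<open>The sum of a family with only finitely many nonzero terms.\<close>

definition fsum :: "('b \<Rightarrow> 'a::comm_monoid_add) \<Rightarrow> 'b set \<Rightarrow> 'a" where
  "fsum f A = (\<Sum>a\<in>{a \<in> A. f a \<noteq> 0}. f a)"

text \<open>\<open>SE k n\<close> is infinite for \<open>k < n\<close>, but for a weight system of finite
  height only finitely many of its paths have nonzero weight.\<close>

definition lh_h :: "'a::comm_semiring_1 weight_system \<Rightarrow> nat \<Rightarrow> nat \<Rightarrow> 'a" where
  "lh_h w n k = fsum (path_weight w) (SE k n)"


section \<open>Continuous q-Hermite polynomials\<close>

definition qpoch :: "'a::comm_ring_1 \<Rightarrow> 'a \<Rightarrow> nat \<Rightarrow> 'a" where
  "qpoch z q k = (\<Prod>i<k. 1 - z * q ^ i)"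

text \<open>The terminating series \<open>\<^sub>2\<phi>\<^sub>0(a, b; -; q, z)\<close>.\<close>

definition phi20 :: "'a::field \<Rightarrow> 'a \<Rightarrow> 'a \<Rightarrow> 'a \<Rightarrow> 'a" where
  "phi20 a b q z =
     fsum (\<lambda>k. qpoch a q k * qpoch b q k / qpoch q q k
               * inverse ((-1) ^ k * q ^ (k choose 2)) * z ^ k) UNIV"

text \<open>The indeterminate \<open>q\<close> is the generator of the field of rational functions over the
  complex numbers; complex coefficients are needed for \<open>e\<^sup>i\<^sup>\<theta>\<close>.\<close>

type_synonym Cq = "complex poly fract"

definition qvar :: Cq where
  "qvar = to_fract [:0, 1:]"

definition Cconst :: "complex \<Rightarrow> Cq" where
  "Cconst c = to_fract [:c:]"

text \<open>\<open>H\<^sub>n(x|q)\<close> is the polynomial in \<open>x\<close> whose value at \<open>x = cos \<theta>\<close>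
  is given by the \<open>\<^sub>2\<phi>\<^sub>0\<close> formula, for every real \<open>\<theta>\<close>.\<close>

definition qHermite :: "nat \<Rightarrow> Cq poly" where
  "qHermite n = (THE P. \<forall>\<theta>::real.
     poly P (Cconst (of_real (cos \<theta>))) =
       Cconst (exp (\<i> * of_nat n * of_real \<theta>)) / 2 ^ n
       * phi20 (qvar powi (- int n)) 0 qvar
           (qvar ^ n * Cconst (exp (- 2 * \<i> * of_real \<theta>))))"

definition sigmaH :: "nat \<Rightarrow> nat \<Rightarrow> Cq" where
  "sigmaH = (THE s. (\<forall>n k. n < k \<longrightarrow> s n k = 0) \<and>
     (\<forall>n. monom 1 n = (\<Sum>k\<le>n. smult (s n k) (qHermite k))))"

definition wH :: "Cq weight_system" where
  "wH t i j =
     (if t = 0 then (qvar ^ j + qvar powi (- int j)) / 2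
      else if t = 1 then - (qvar powi (int j - int i)) / 2
      else if t = 2 then - (qvar powi (int i - int j)) / 2
      else 0)"

lemma height_wH: "height wH = 3"
  unfolding height_def
proof (rule Least_equality)
  show "\<forall>t\<ge>3. \<forall>i. \<forall>j\<le>i. wH t i j = 0"
    by (auto simp: wH_def)
next
  fix l assume l: "\<forall>t\<ge>l. \<forall>i. \<forall>j\<le>i. wH t i j = 0"
  have "(2::Cq) = to_fract 2"
    by (metis one_add_one to_fract_1 to_fract_add)
  then have "(2::Cq) \<noteq> 0" by (metis to_fract_eq_0_iff zero_neq_numeral)
  then have "wH 2 0 0 \<noteq> 0" by (simp add: wH_def)
  with l show "3 \<le> l" by (metis le_refl not_less_eq_eq numeral_2_eq_2 numeral_3_eq_3)
qed

end

(* Write x for the variable and c = -1/2, and let V n N be the sum over k of H_k(x|q) times the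
   weight sum of all paths that come down column k and end at the N-th vertex of column n. Splitting
   off the last step gives a recurrence for V, and V is H_n above height 3. Going down through one
   unit strip at a time turns V n into three further families of polynomials:
   at height 2 the continuous big q-Hermite polynomials with parameter 1,
   Q_{n+1} = (x + c q^n) Q_n - c^2 (1 - q^n) Q_{n-1};
   at height 1 the products P_n of the factors x - (q^i + q^{-i})/2 with i < n;
   at height 0 the monomials x^n, which is the assertion.
   In the two upper strips the weights are c p^{i-j} with p = q resp. p = 1/q, so the strip acts
   as the product of the operators E + c p^i, where E is the shift of a sequence; this product
   is expanded by the q-binomial theorem. *)
theory Submission
  imports Defs
begin

section \<open>Gaussian binomial coefficients\<close>

text \<open>Defined by the q-Pascal rule rather than as a quotient of q-factorials: this needs no
  division, so both \<open>q\<close> and its inverse can serve as the base.\<close>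

fun qbinom :: "'a::comm_ring_1 \<Rightarrow> nat \<Rightarrow> nat \<Rightarrow> 'a" where
  "qbinom q n 0 = 1"
| "qbinom q 0 (Suc k) = 0"
| "qbinom q (Suc n) (Suc k) = q ^ Suc k * qbinom q n (Suc k) + qbinom q n k"

lemma qbinom_eq_0: "n < k \<Longrightarrow> qbinom q n k = 0"
  by (induction q n k rule: qbinom.induct) auto

lemma qbinom_self: "qbinom q n n = 1"
  by (induction n) (auto simp: qbinom_eq_0)

text \<open>The ratio of neighbouring entries in a row, cleared of denominators; it stands in for
  the factorial formula. In the induction both sides for \<open>Suc n\<close> become
  \<open>(1 - q ^ Suc n) * qbinom q n k\<close>, by the Pascal rule and the induction hypothesis at
  \<open>k\<close> resp. \<open>k - 1\<close>.\<close>

lemma qbinom_step: "(1 - q ^ Suc k) * qbinom q n (Suc k) = (1 - q ^ (n - k)) * qbinom q n k"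
proof (induction n arbitrary: k)
  case 0
  then show ?case by (cases k) auto
next
  case (Suc n)
  show ?case
  proof (cases k)
    case 0
    have "(1 - q ^ Suc 0) * qbinom q (Suc n) (Suc 0)
        = q * ((1 - q ^ Suc 0) * qbinom q n (Suc 0)) + (1 - q)"
      by (simp add: algebra_simps)
    also have "\<dots> = 1 - q ^ Suc n"
      unfolding Suc.IH by (simp add: algebra_simps)
    finally show ?thesis using 0 by simp
  next
    case (Suc k')
    show ?thesis
    proof (cases "k \<le> n")
      case True
      have qk: "q ^ Suc k * q ^ (n - k) = q ^ Suc n" "q ^ k * q ^ (Suc n - k) = q ^ Suc n"
        using True by (simp_all add: Suc_diff_le flip: power_add power_Suc)
      have "(1 - q ^ Suc k) * qbinom q (Suc n) (Suc k)
          = q ^ Suc k * ((1 - q ^ Suc k) * qbinom q n (Suc k)) + (1 - q ^ Suc k) * qbinom q n k"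
        by (simp add: algebra_simps)
      also have "\<dots> = (1 - q ^ Suc k * q ^ (n - k)) * qbinom q n k"
        unfolding Suc.IH by (simp add: algebra_simps)
      finally have l: "(1 - q ^ Suc k) * qbinom q (Suc n) (Suc k) = (1 - q ^ Suc n) * qbinom q n k"
        unfolding qk .
      have "n - k' = Suc n - k"
        using Suc by simp
      then have ih: "(1 - q ^ k) * qbinom q n k = (1 - q ^ (Suc n - k)) * qbinom q n k'"
        using Suc.IH[of k'] Suc by simp
      have "(1 - q ^ (Suc n - k)) * qbinom q (Suc n) k
          = (q ^ k - q ^ k * q ^ (Suc n - k)) * qbinom q n k
            + (1 - q ^ (Suc n - k)) * qbinom q n k'"
        using Suc by (simp add: algebra_simps)
      also have "\<dots> = (1 - q ^ Suc n) * qbinom q n k"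
        unfolding ih[symmetric] qk by (simp add: algebra_simps)
      finally show ?thesis using l by simp
    next
      case False
      then show ?thesis by (simp add: qbinom_eq_0)
    qed
  qed
qed

text \<open>The second q-Pascal rule; it differs from the defining one by exactly the ratio identity
  \<open>qbinom_step\<close>.\<close>

lemma qbinom_Suc_Suc':
  "qbinom q (Suc n) (Suc k) = qbinom q n (Suc k) + q ^ (n - k) * qbinom q n k"
  using qbinom_step[of q k n] by (simp add: algebra_simps)

lemma qbinom_absorb:
  "(1 - q ^ Suc k) * qbinom q (Suc n) (Suc k) = (1 - q ^ Suc n) * qbinom q n k"
proof (cases "k \<le> n")
  case True
  then have qk: "q ^ Suc k * q ^ (n - k) = q ^ Suc n"
    by (simp flip: power_add power_Suc)
  have "(1 - q ^ Suc k) * qbinom q (Suc n) (Suc k)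
      = q ^ Suc k * ((1 - q ^ Suc k) * qbinom q n (Suc k)) + (1 - q ^ Suc k) * qbinom q n k"
    by (simp add: algebra_simps)
  also have "\<dots> = (1 - q ^ Suc k * q ^ (n - k)) * qbinom q n k"
    unfolding qbinom_step by (simp add: algebra_simps)
  finally show ?thesis unfolding qk .
qed (simp add: qbinom_eq_0)

lemma qbinom_absorb_comp:
  "(1 - q ^ (Suc n - k)) * qbinom q (Suc n) k = (1 - q ^ Suc n) * qbinom q n k"
  using qbinom_step[of q k "Suc n"] qbinom_absorb[of q k n] by simp

text \<open>\<open>r\<close> is the homogeneous Rogers-Szego polynomial. Coefficientwise the
  recurrence is the Pascal rule, because \<open>(1 - q ^ Suc n) * qbinom q n k\<close> equals
  \<open>(1 - q ^ Suc k) * qbinom q (Suc n) (Suc k)\<close>.\<close>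

lemma rogers_szego_rec:
  fixes q u v :: "'a::comm_ring_1"
  defines "r \<equiv> \<lambda>n. \<Sum>k\<le>n. qbinom q n k * u ^ (n - k) * v ^ k"
  shows "r (Suc (Suc n)) = (u + v) * r (Suc n) - (1 - q ^ Suc n) * (u * v) * r n"
proof -
  have u: "u * r (Suc n) = u ^ Suc (Suc n)
      + (\<Sum>k\<le>n. qbinom q (Suc n) (Suc k) * u ^ (Suc n - k) * v ^ Suc k)"
  proof -
    have "u * r (Suc n) = u ^ Suc (Suc n)
        + (\<Sum>k\<le>n. u * (qbinom q (Suc n) (Suc k) * u ^ (n - k) * v ^ Suc k))"
      unfolding r_def by (subst sum.atMost_Suc_shift) (simp add: sum_distrib_left algebra_simps)
    also have "(\<Sum>k\<le>n. u * (qbinom q (Suc n) (Suc k) * u ^ (n - k) * v ^ Suc k))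
       = (\<Sum>k\<le>n. qbinom q (Suc n) (Suc k) * u ^ (Suc n - k) * v ^ Suc k)"
      by (rule sum.cong) (simp_all add: Suc_diff_le algebra_simps)
    finally show ?thesis .
  qed
  have v: "v * r (Suc n) = v ^ Suc (Suc n)
      + (\<Sum>k\<le>n. qbinom q (Suc n) k * u ^ (Suc n - k) * v ^ Suc k)"
    unfolding r_def
    by (simp add: qbinom_self sum_distrib_left algebra_simps del: qbinom.simps)
  have uv: "(1 - q ^ Suc n) * (u * v) * r n
      = (\<Sum>k\<le>n. (1 - q ^ Suc n) * qbinom q n k * u ^ (Suc n - k) * v ^ Suc k)"
    unfolding r_def sum_distrib_left
    by (rule sum.cong) (simp_all add: Suc_diff_le algebra_simps)
  have "r (Suc (Suc n)) = u ^ Suc (Suc n)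
      + (\<Sum>k\<le>Suc n. qbinom q (Suc (Suc n)) (Suc k) * u ^ (Suc n - k) * v ^ Suc k)"
    unfolding r_def by (subst sum.atMost_Suc_shift) simp
  also have "\<dots> = u ^ Suc (Suc n) + v ^ Suc (Suc n)
      + (\<Sum>k\<le>n. qbinom q (Suc (Suc n)) (Suc k) * u ^ (Suc n - k) * v ^ Suc k)"
    by (simp add: qbinom_self del: qbinom.simps)
  also have "(\<Sum>k\<le>n. qbinom q (Suc (Suc n)) (Suc k) * u ^ (Suc n - k) * v ^ Suc k)
      = (\<Sum>k\<le>n. qbinom q (Suc n) (Suc k) * u ^ (Suc n - k) * v ^ Suc k)
      + (\<Sum>k\<le>n. qbinom q (Suc n) k * u ^ (Suc n - k) * v ^ Suc k)
      - (\<Sum>k\<le>n. (1 - q ^ Suc n) * qbinom q n k * u ^ (Suc n - k) * v ^ Suc k)"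
    unfolding sum.distrib[symmetric] sum_subtractf[symmetric] qbinom_absorb[of q _ n, symmetric]
      qbinom.simps(3)[of q "Suc n"]
    by (rule sum.cong) (simp_all only: refl algebra_simps mult_1_left)
  finally show ?thesis
    unfolding distrib_right[of u v] u v uv by (simp only: algebra_simps)
qed

section \<open>Products of shift operators and three-term recurrences\<close>

text \<open>With the shift \<open>E\<close> on sequences, this is \<open>(\<Prod>i<N. E + c * p ^ i) f\<close> at \<open>j\<close>.\<close>

fun qshift :: "'a::comm_ring_1 \<Rightarrow> 'a \<Rightarrow> (nat \<Rightarrow> 'a) \<Rightarrow> nat \<Rightarrow> nat \<Rightarrow> 'a" where
  "qshift p c f 0 j = f j"
| "qshift p c f (Suc N) j = qshift p c f N (Suc j) + c * p ^ N * qshift p c f N j"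

text \<open>The q-binomial theorem for operators. Coefficientwise the recursion is the second Pascal
  rule: its factor \<open>p ^ (N - m)\<close> and the \<open>p ^ m\<close> gained from
  \<open>Suc m choose 2\<close> combine to \<open>p ^ N\<close>.\<close>

lemma qshift_sum:
  "qshift p c f N j = (\<Sum>m\<le>N. qbinom p N m * p ^ (m choose 2) * c ^ m * f (j + (N - m)))"
proof (induction N arbitrary: j)
  case 0
  then show ?case by (simp add: numeral_2_eq_2)
next
  case (Suc N)
  let ?t = "\<lambda>N j m. qbinom p N m * p ^ (m choose 2) * c ^ m * f (j + (N - m))"
  have ch: "Suc m choose 2 = m + (m choose 2)" for m
    by (simp add: numeral_2_eq_2)
  have e: "?t (Suc N) j (Suc m) = ?t N (Suc j) (Suc m) + c * p ^ N * ?t N j m" if "m \<le> N" for m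
  proof (cases "m = N")
    \<comment> \<open>Here the truncated \<open>N - Suc m\<close> is 0 instead of -1, but the
      coefficient \<open>qbinom p N (Suc N)\<close> in front of that term vanishes.\<close>
    case True
    then show ?thesis
      by (simp add: qbinom_Suc_Suc' ch qbinom_eq_0 power_add algebra_simps del: qbinom.simps)
  next
    case False
    with that obtain d where "N = Suc (m + d)"
      using less_imp_Suc_add[of m N] by auto
    then show ?thesis
      by (simp add: qbinom_Suc_Suc' ch power_add algebra_simps del: qbinom.simps)
  qed
  have "qshift p c f N (Suc j) = (\<Sum>m\<le>Suc N. ?t N (Suc j) m)"
    unfolding Suc.IH by (simp add: qbinom_eq_0)
  also have "\<dots> = ?t N (Suc j) 0 + (\<Sum>m\<le>N. ?t N (Suc j) (Suc m))"
    by (subst sum.atMost_Suc_shift) simp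
  finally have "qshift p c f (Suc N) j
      = ?t N (Suc j) 0 + (\<Sum>m\<le>N. ?t N (Suc j) (Suc m) + c * p ^ N * ?t N j m)"
    by (simp add: Suc.IH sum.distrib sum_distrib_left)
  also have "\<dots> = ?t (Suc N) j 0 + (\<Sum>m\<le>N. ?t (Suc N) j (Suc m))"
    using e by simp
  also have "\<dots> = (\<Sum>m\<le>Suc N. ?t (Suc N) j m)"
    by (subst sum.atMost_Suc_shift) simp
  finally show ?case .
qed

text \<open>Inserting the recurrence of \<open>f\<close> into the q-binomial expansion, the last
  term is absorbed by \<open>(1 - q ^ (n - m)) * qbinom q n m = (1 - q ^ n) * qbinom q (n - 1)
  m\<close>. At \<open>l = 0\<close> the factor \<open>1 - q ^ l\<close> removes the truncated
  \<open>f (l - 1)\<close>.\<close>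

lemma qshift_three_term:
  fixes f :: "nat \<Rightarrow> 'a::comm_ring_1"
  assumes f: "\<And>l. f (Suc l) = x * f l - d * (1 - q ^ l) * f (l - 1)"
  shows "qshift q c f (Suc n) 0
    = (x + c * q ^ n) * qshift q c f n 0 - d * (1 - q ^ n) * qshift q c f (n - 1) 0"
proof -
  let ?b = "\<lambda>m. q ^ (m choose 2) * c ^ m"
  have s: "(\<Sum>m\<le>n. qbinom q n m * ?b m * ((1 - q ^ (n - m)) * f (n - m - 1)))
    = (1 - q ^ n) * qshift q c f (n - 1) 0"
  proof (cases n)
    case 0
    then show ?thesis by simp
  next
    case (Suc n')
    have "(\<Sum>m\<le>n. qbinom q n m * ?b m * ((1 - q ^ (n - m)) * f (n - m - 1)))
      = (\<Sum>m\<le>n. ?b m * f (n - m - 1) * ((1 - q ^ (Suc n' - m)) * qbinom q (Suc n') m))"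
      unfolding Suc by (simp only: mult_ac)
    also have "\<dots> = (\<Sum>m\<le>n'. (1 - q ^ n) * (qbinom q n' m * ?b m * f (n' - m)))"
      unfolding qbinom_absorb_comp unfolding Suc
      by (simp add: qbinom_eq_0 mult_ac del: power_Suc)
    finally show ?thesis
      unfolding Suc by (simp add: qshift_sum sum_distrib_left mult_ac)
  qed
  have "qshift q c f n (Suc 0) = (\<Sum>m\<le>n. qbinom q n m * ?b m * f (Suc (n - m)))"
    by (simp add: qshift_sum mult_ac)
  also have "\<dots> = (\<Sum>m\<le>n. x * (qbinom q n m * ?b m * f (n - m))
      - d * (qbinom q n m * ?b m * ((1 - q ^ (n - m)) * f (n - m - 1))))"
    unfolding f by (rule sum.cong) (simp_all only: refl algebra_simps)
  also have "\<dots> = x * qshift q c f n 0 - d * ((1 - q ^ n) * qshift q c f (n - 1) 0)"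
    unfolding sum_subtractf sum_distrib_left[symmetric] s by (simp add: qshift_sum mult_ac)
  finally show ?thesis
    by (simp add: algebra_simps)
qed

text \<open>In the expansion in base \<open>p\<close>, each \<open>q ^ (n - m)\<close> coming from
  the recurrence of \<open>f\<close> is replaced by \<open>q ^ n\<close>. The resulting error terms
  cancel against the terms with \<open>c\<^sup>2\<close> after a shift of \<open>m\<close> by one,
  so the three-term recurrence collapses to a first-order one.\<close>

lemma qshift_factor:
  fixes f :: "nat \<Rightarrow> 'a::comm_ring_1"
  assumes f: "\<And>l. f (Suc l) = (x + c * q ^ l) * f l - c\<^sup>2 * (1 - q ^ l) * f (l - 1)"
    and pq: "p * q = 1"
  shows "qshift p c f (Suc n) 0 = (x + c * q ^ n + c * p ^ n) * qshift p c f n 0"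
proof -
  let ?b = "\<lambda>m. p ^ (m choose 2) * c ^ m"
  have pqm: "p ^ m * q ^ m = 1" for m
    using pq by (simp flip: power_mult_distrib)
  have ch: "Suc m choose 2 = m + (m choose 2)" for m
    by (simp add: numeral_2_eq_2)
  \<comment> \<open>Both sides are coefficients of \<open>f (n - Suc m)\<close>: on the left the
    error term of index \<open>Suc m\<close>, on the right the term with \<open>c\<^sup>2\<close> of
    index \<open>m\<close>.\<close>
  have e: "c * (q ^ n - q ^ (n - Suc m)) * (qbinom p n (Suc m) * ?b (Suc m))
      = - (c\<^sup>2) * (qbinom p n m * ?b m * (1 - q ^ (n - m)))" if m: "Suc m \<le> n" for m
  proof -
    obtain d where "n = Suc m + d"
      using m le_Suc_ex by blast
    then have qn: "q ^ n = q ^ (n - Suc m) * q ^ Suc m" "q ^ (n - m) = q ^ (n - Suc m) * q"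
      by (simp_all add: power_add mult_ac)
    \<comment> \<open>The power \<open>p ^ m\<close> from \<open>Suc m choose 2\<close> turns the
      difference of powers of \<open>q\<close> into a multiple of \<open>1 - p ^ Suc m\<close>, to
      which \<open>qbinom_step\<close> in base \<open>p\<close> applies.\<close>
    have q1: "(q ^ n - q ^ (n - Suc m)) * p ^ m = q ^ (n - m) * (1 - p ^ Suc m)"
    proof -
      have "(q ^ n - q ^ (n - Suc m)) * p ^ m
          = q ^ (n - Suc m) * (q * (p ^ m * q ^ m) - p ^ m * (p * q))"
        unfolding qn pq by (simp add: algebra_simps)
      also have "\<dots> = q ^ (n - Suc m) * (q - p ^ m * (p * q))"
        by (simp only: pqm mult_1_right)
      finally show ?thesis
        unfolding qn by (simp add: algebra_simps)
    qed
    have q2: "q ^ (n - m) * (1 - p ^ (n - m)) = - (1 - q ^ (n - m))"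
      using pqm[of "n - m"] by (simp add: algebra_simps)
    have "c * (q ^ n - q ^ (n - Suc m)) * (qbinom p n (Suc m) * ?b (Suc m))
        = c\<^sup>2 * ?b m * (((q ^ n - q ^ (n - Suc m)) * p ^ m) * qbinom p n (Suc m))"
      by (simp add: ch power_add power2_eq_square mult_ac)
    also have "\<dots> = c\<^sup>2 * ?b m * (q ^ (n - m) * ((1 - p ^ Suc m) * qbinom p n (Suc m)))"
      unfolding q1 by (simp only: mult_ac)
    also have "\<dots> = c\<^sup>2 * ?b m * ((q ^ (n - m) * (1 - p ^ (n - m))) * qbinom p n m)"
      unfolding qbinom_step by (simp only: mult_ac)
    finally show ?thesis
      unfolding q2 by (simp only: mult_ac mult_minus_left mult_minus_right)
  qed
  \<comment> \<open>The ends fit under the index shift: the left summand vanishes at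
    \<open>m = 0\<close>, the right one at \<open>m = n\<close>.\<close>
  have s: "(\<Sum>m\<le>n. c * (q ^ n - q ^ (n - m)) * (qbinom p n m * ?b m) * f (n - m))
      = (\<Sum>m\<le>n. - (c\<^sup>2) * (qbinom p n m * ?b m * (1 - q ^ (n - m))) * f (n - m - 1))"
  proof (cases n)
    case 0
    then show ?thesis by simp
  next
    case (Suc n')
    have "(\<Sum>m\<le>n. c * (q ^ n - q ^ (n - m)) * (qbinom p n m * ?b m) * f (n - m))
      = (\<Sum>m\<le>n'. c * (q ^ n - q ^ (n - Suc m)) * (qbinom p n (Suc m) * ?b (Suc m)) * f (n - Suc m))"
      unfolding Suc by (subst sum.atMost_Suc_shift) (simp del: power_Suc)
    also have "\<dots> = (\<Sum>m\<le>n'. - (c\<^sup>2) * (qbinom p n m * ?b m * (1 - q ^ (n - m))) * f (n - m - 1))"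
      by (rule sum.cong) (use e Suc in \<open>simp_all del: power_Suc qbinom.simps\<close>)
    also have "\<dots> = (\<Sum>m\<le>n. - (c\<^sup>2) * (qbinom p n m * ?b m * (1 - q ^ (n - m))) * f (n - m - 1))"
      unfolding Suc by simp
    finally show ?thesis .
  qed
  have "qshift p c f n (Suc 0) = (\<Sum>m\<le>n. qbinom p n m * ?b m * f (Suc (n - m)))"
    by (simp add: qshift_sum mult_ac)
  also have "\<dots> = (\<Sum>m\<le>n. (x + c * q ^ n) * (qbinom p n m * ?b m * f (n - m))
       - c * (q ^ n - q ^ (n - m)) * (qbinom p n m * ?b m) * f (n - m)
       + - (c\<^sup>2) * (qbinom p n m * ?b m * (1 - q ^ (n - m))) * f (n - m - 1))"
    unfolding f by (rule sum.cong) (simp_all add: algebra_simps)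
  also have "\<dots> = (x + c * q ^ n) * qshift p c f n 0"
    unfolding sum.distrib sum_subtractf s by (simp add: qshift_sum sum_distrib_left mult_ac)
  finally show ?thesis
    by (simp add: algebra_simps)
qed

section \<open>Paths in the lecture hall graph\<close>

lemma fsum_eq_sum:
  assumes "finite B" "{a \<in> A. f a \<noteq> 0} \<subseteq> B" "B \<subseteq> A"
  shows "fsum f A = sum f B"
  unfolding fsum_def by (rule sum.mono_neutral_left) (use assms in auto)

lemma fsum_cong: "(\<And>a. a \<in> A \<Longrightarrow> f a = g a) \<Longrightarrow> fsum f A = fsum g A"
  unfolding fsum_def by (rule sum.cong) auto

lemma fsum_Un_disjoint:
  assumes "finite {a \<in> A. f a \<noteq> 0}" "finite {a \<in> B. f a \<noteq> 0}" "A \<inter> B = {}"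
  shows "fsum f (A \<union> B) = fsum f A + fsum f B"
proof -
  have "{a \<in> A \<union> B. f a \<noteq> 0} = {a \<in> A. f a \<noteq> 0} \<union> {a \<in> B. f a \<noteq> 0}" by auto
  then show ?thesis
    unfolding fsum_def using assms by (simp add: sum.union_disjoint disjoint_iff)
qed

lemma fsum_image:
  assumes "inj_on g A"
  shows "fsum f (g ` A) = fsum (f \<circ> g) A"
proof -
  have "{b \<in> g ` A. f b \<noteq> 0} = g ` {a \<in> A. f (g a) \<noteq> 0}" by auto
  moreover have "inj_on g {a \<in> A. f (g a) \<noteq> 0}"
    using assms by (rule inj_on_subset) auto
  ultimately show ?thesis
    unfolding fsum_def by (simp add: sum.reindex)
qed

lemma fsum_mult_left:
  fixes c :: "'a::comm_semiring_1"
  assumes "finite {a \<in> A. f a \<noteq> 0}"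
  shows "fsum (\<lambda>a. c * f a) A = c * fsum f A"
proof -
  have "fsum (\<lambda>a. c * f a) A = (\<Sum>a\<in>{a \<in> A. f a \<noteq> 0}. c * f a)"
    by (rule fsum_eq_sum) (use assms in auto)
  then show ?thesis by (simp add: fsum_def sum_distrib_left)
qed

section \<open>Integer coordinates for vertices and steps\<close>

text \<open>Column \<open>i\<close> consists of the points \<open>lh_point i N\<close>; here \<open>N = t * (i + 1) + j\<close> for
  \<open>v\<^sup>t\<^bsub>i,j\<^esub>\<close>, so that south steps decrease \<open>N\<close> by one.\<close>

definition lh_point :: "nat \<Rightarrow> nat \<Rightarrow> point" where
  "lh_point i N = (real i, real N / (real i + 1))"

text \<open>The west neighbour keeps the labels \<open>t, j\<close>, so the index
  \<open>t * (n + 1) + j\<close> becomes \<open>t * n + j\<close> in column \<open>n - 1\<close>.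
  There is an edge only if \<open>j < n\<close>.\<close>

definition lh_west :: "nat \<Rightarrow> nat \<Rightarrow> point" where
  "lh_west n N = lh_point (n - 1) (N div (n + 1) * n + N mod (n + 1))"

lemma lh_vertex_point: "lh_vertex t i j = lh_point i (t * (i + 1) + j)"
  by (simp add: lh_vertex_def lh_point_def field_simps)

lemma lh_point_inj: "lh_point i N = lh_point i' N' \<longleftrightarrow> i = i' \<and> N = N'"
  by (auto simp: lh_point_def)

lemma south_step_point: "south_step u (lh_point n N) \<longleftrightarrow> u = lh_point n (Suc N)"
proof
  assume "u = lh_point n (Suc N)"
  then have "u = lh_vertex (N div (n + 1)) n (N mod (n + 1) + 1)"
    "lh_point n N = lh_vertex (N div (n + 1)) n (N mod (n + 1))"
    by (simp_all only: lh_vertex_point lh_point_inj)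
      (metis add_Suc_right Suc_eq_plus1 div_mult_mod_eq, metis div_mult_mod_eq)
  moreover have "N mod (n + 1) \<le> n" by (simp add: less_Suc_eq_le[symmetric])
  ultimately show "south_step u (lh_point n N)" unfolding south_step_def by blast
qed (auto simp: south_step_def lh_vertex_point lh_point_inj)

text \<open>As \<open>j < n + 1\<close>, division of \<open>N\<close> by \<open>n + 1\<close>
  recovers the labels. The remainder \<open>n\<close> cannot occur, since
  \<open>j \<le> n - 1\<close> at the start of the step.\<close>

lemma east_label_unique:
  assumes "j \<le> i" "lh_point n N = lh_vertex t (i + 1) j"
  shows "i = n - 1" "t = N div (n + 1)" "j = N mod (n + 1)" "N mod (n + 1) < n"
proof -
  have n: "n = i + 1" and N: "N = t * (n + 1) + j"
    using assms(2) by (auto simp: lh_vertex_point lh_point_inj)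
  show "t = N div (n + 1)" "j = N mod (n + 1)"
    unfolding N using assms(1) n by (simp_all only: div_mult_self3 mod_mult_self3) auto
  then show "i = n - 1" "N mod (n + 1) < n"
    using assms(1) n by auto
qed

lemma east_label_exists:
  assumes "N mod (n + 1) < n"
  shows "lh_point n N = lh_vertex (N div (n + 1)) (n - 1 + 1) (N mod (n + 1))"
    and "lh_west n N = lh_vertex (N div (n + 1)) (n - 1) (N mod (n + 1))"
proof -
  show "lh_west n N = lh_vertex (N div (n + 1)) (n - 1) (N mod (n + 1))"
    using assms by (simp add: lh_west_def lh_vertex_point)
  show "lh_point n N = lh_vertex (N div (n + 1)) (n - 1 + 1) (N mod (n + 1))"
    unfolding lh_vertex_point lh_point_inj using assms div_mult_mod_eq[of N "n + 1"] by simp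
qed

text \<open>Determines at once when an east step into a given point exists and which label it
  contributes to the weight of a path.\<close>

lemma east_labels:
  "{(t, i, j). j \<le> i \<and> u = lh_vertex t i j \<and> lh_point n N = lh_vertex t (i + 1) j}
    = (if N mod (n + 1) < n \<and> u = lh_west n N
       then {(N div (n + 1), n - 1, N mod (n + 1))} else {})"
proof (cases "N mod (n + 1) < n")
  case True
  have "j \<le> i \<and> u = lh_vertex t i j \<and> lh_point n N = lh_vertex t (i + 1) j \<longleftrightarrow>
     u = lh_west n N \<and> t = N div (n + 1) \<and> i = n - 1 \<and> j = N mod (n + 1)" for t i j
    using east_label_unique[of j i n N t] east_label_exists[OF True] True
    by (metis Suc_eq_plus1 Suc_pred' less_Suc_eq_le less_nat_zero_code neq0_conv)
  then show ?thesis using True by auto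
next
  case False
  then show ?thesis using east_label_unique(4)[of _ _ n N] by auto
qed

lemma east_step_labels:
  "east_step u v \<longleftrightarrow>
    {(t, i, j). j \<le> i \<and> u = lh_vertex t i j \<and> v = lh_vertex t (i + 1) j} \<noteq> {}"
  unfolding east_step_def by auto

lemma east_step_point: "east_step u (lh_point n N) \<longleftrightarrow> N mod (n + 1) < n \<and> u = lh_west n N"
  unfolding east_step_labels east_labels by simp

section \<open>Weights of paths under removal of the last step\<close>

definition east_indices :: "(nat \<Rightarrow> point) \<Rightarrow> (nat \<times> nat \<times> nat \<times> nat) set" where
  "east_indices p = {(m, t, i, j). j \<le> i \<and>
     p (Suc m) = lh_vertex t i j \<and> p m = lh_vertex t (i + 1) j}"

lemma path_weight_alt: "path_weight w p = (\<Prod>(m, t, i, j)\<in>east_indices p. w t i j)"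
  by (simp add: path_weight_def east_indices_def)

text \<open>Paths with an arbitrary end point \<open>a\<close>, since removing the last step moves
  the end point away from height 0.\<close>

definition SE_from :: "nat \<Rightarrow> point \<Rightarrow> (nat \<Rightarrow> point) set" where
  "SE_from k a = {p. p 0 = a \<and>
     (\<forall>m. south_step (p (Suc m)) (p m) \<or> east_step (p (Suc m)) (p m)) \<and>
     (\<lambda>m. fst (p m)) \<longlonglongrightarrow> real k \<and> filterlim (\<lambda>m. snd (p m)) at_top sequentially}"

lemma SE_eq_SE_from: "SE k n = SE_from k (lh_point n 0)"
  by (simp add: SE_def SE_from_def lh_point_def)

text \<open>The first coordinates converge, so their consecutive differences are eventually below 1,
  whereas an east step changes the first coordinate by exactly 1. Finiteness matters because
  \<open>prod\<close> over an infinite set is 1 by convention.\<close>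

lemma finite_east_indices:
  assumes "p \<in> SE_from k a"
  shows "finite (east_indices p)"
proof -
  from assms have lim: "(\<lambda>m. fst (p m)) \<longlonglongrightarrow> real k" by (simp add: SE_from_def)
  then have "(\<lambda>m. fst (p m) - fst (p (Suc m))) \<longlonglongrightarrow> real k - real k"
    by (intro tendsto_diff LIMSEQ_Suc)
  then have "\<forall>\<^sub>F m in sequentially. fst (p m) - fst (p (Suc m)) < 1"
    by (rule order_tendstoD) simp
  then obtain M where M: "\<And>m. m \<ge> M \<Longrightarrow> fst (p m) - fst (p (Suc m)) < 1"
    by (auto simp: eventually_sequentially)
  let ?L = "\<lambda>m. {(t, i, j). j \<le> i \<and> p (Suc m) = lh_vertex t i j \<and> p m = lh_vertex t (i + 1) j}"
  have "finite (?L m)" for m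
  proof (cases "?L m = {}")
    case True
    then show ?thesis by (rule ssubst) simp
  next
    case False
    then obtain n N where "p m = lh_point n N" unfolding lh_vertex_point by blast
    then show ?thesis unfolding \<open>p m = lh_point n N\<close> east_labels by simp
  qed
  then have "finite (SIGMA m:{..<M}. ?L m)" by (rule finite_SigmaI[OF finite_lessThan])
  moreover have "east_indices p \<subseteq> (SIGMA m:{..<M}. ?L m)"
  proof
    fix x assume x: "x \<in> east_indices p"
    then obtain m t i j where xe: "x = (m, t, i, j)"
      and l: "p (Suc m) = lh_vertex t i j" "p m = lh_vertex t (i + 1) j" "j \<le> i"
      by (auto simp: east_indices_def)
    have "fst (p m) - fst (p (Suc m)) = 1" using l by (simp add: lh_vertex_def)
    then have "m < M" using M[of m] by (cases "m < M") auto
    then show "x \<in> (SIGMA m:{..<M}. ?L m)" using xe l by simp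
  qed
  ultimately show ?thesis by (rule finite_subset[rotated])
qed

lemma path_weight_eq_0:
  assumes "p \<in> SE_from k a" "p m = lh_point n N" "east_step (p (Suc m)) (p m)"
    and "w (N div (n + 1)) (n - 1) (N mod (n + 1)) = 0"
  shows "path_weight w p = 0"
proof -
  from assms(2,3) have e: "N mod (n + 1) < n" "p (Suc m) = lh_west n N"
    by (auto simp: east_step_point)
  then have "(m, N div (n + 1), n - 1, N mod (n + 1)) \<in> east_indices p"
    using east_label_exists[OF e(1)] assms(2) by (auto simp: east_indices_def)
  then show ?thesis unfolding path_weight_alt
    using finite_east_indices[OF assms(1)] assms(4) by (intro prod_zero) force+
qed

lemma east_indices_case_nat:
  "east_indices (case_nat a p) = Pair 0 ` {(t, i, j). j \<le> i \<and> p 0 = lh_vertex t i j \<and>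
      a = lh_vertex t (i + 1) j} \<union> apfst Suc ` east_indices p" (is "?l = ?a \<union> ?b")
proof (rule set_eqI, safe)
  fix m t i j assume x: "(m, t, i, j) \<in> ?l" "(m, t, i, j) \<notin> ?b"
  then show "(m, t, i, j) \<in> ?a"
    by (cases m) (force simp: east_indices_def image_iff)+
qed (auto simp: east_indices_def)

lemma path_weight_south:
  assumes "p 0 = lh_point n (Suc N)"
  shows "path_weight w (case_nat (lh_point n N) p) = path_weight w p"
proof -
  \<comment> \<open>For \<open>n = 0\<close> the truncated \<open>n - 1\<close> leaves
    \<open>lh_west\<close> in column 0, but at index 0, which differs from
    \<open>Suc N\<close>.\<close>
  have "lh_point n (Suc N) \<noteq> lh_west n N"
    by (cases n) (auto simp: lh_west_def lh_point_inj)
  then have "east_indices (case_nat (lh_point n N) p) = apfst Suc ` east_indices p"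
    unfolding east_indices_case_nat east_labels using assms by simp
  moreover have "inj_on (apfst Suc) A" for A :: "(nat \<times> nat \<times> nat \<times> nat) set"
    by (auto simp: inj_on_def)
  ultimately show ?thesis unfolding path_weight_alt
    by (simp add: prod.reindex case_prod_unfold)
qed

lemma path_weight_east:
  assumes "p \<in> SE_from k (lh_west n N)" "N mod (n + 1) < n"
  shows "path_weight w (case_nat (lh_point n N) p)
    = w (N div (n + 1)) (n - 1) (N mod (n + 1)) * path_weight w p"
proof -
  have "p 0 = lh_west n N" using assms by (simp add: SE_from_def)
  then have "east_indices (case_nat (lh_point n N) p)
      = insert (0, N div (n + 1), n - 1, N mod (n + 1)) (apfst Suc ` east_indices p)"
    unfolding east_indices_case_nat east_labels using assms by simp
  moreover have "inj_on (apfst Suc) A" for A :: "(nat \<times> nat \<times> nat \<times> nat) set"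
    by (auto simp: inj_on_def)
  moreover have "(0, N div (n + 1), n - 1, N mod (n + 1)) \<notin> apfst Suc ` east_indices p"
    by auto
  ultimately show ?thesis unfolding path_weight_alt
    using finite_east_indices[OF assms(1)]
    by (simp add: prod.reindex case_prod_unfold)
qed

text \<open>Dropping the end point only shifts the sequence by one, which changes neither of the two
  limits.\<close>

lemma SE_from_Cons:
  "case_nat a p \<in> SE_from k a \<longleftrightarrow>
     (south_step (p 0) a \<or> east_step (p 0) a) \<and> p \<in> SE_from k (p 0)"
proof -
  let ?p = "case_nat a p"
  have all_nat: "(\<forall>m. P m) \<longleftrightarrow> P 0 \<and> (\<forall>m. P (Suc m))" for P :: "nat \<Rightarrow> bool"
    by (metis not0_implies_Suc)
  have "(\<forall>m. south_step (?p (Suc m)) (?p m) \<or> east_step (?p (Suc m)) (?p m)) \<longleftrightarrow>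
    (south_step (p 0) a \<or> east_step (p 0) a) \<and>
    (\<forall>m. south_step (p (Suc m)) (p m) \<or> east_step (p (Suc m)) (p m))"
    (is "(\<forall>m. ?P m) \<longleftrightarrow> _")
    using all_nat[of ?P] by simp
  then show ?thesis
    using filterlim_sequentially_Suc[of "\<lambda>m. fst (?p m)" "nhds (real k)"]
      filterlim_sequentially_Suc[of "\<lambda>m. snd (?p m)" at_top]
    by (auto simp: SE_from_def)
qed

lemma SE_from_point:
  "SE_from k (lh_point n N) = case_nat (lh_point n N) ` SE_from k (lh_point n (Suc N)) \<union>
     (if N mod (n + 1) < n then case_nat (lh_point n N) ` SE_from k (lh_west n N) else {})"
proof (rule set_eqI)
  fix p
  let ?a = "lh_point n N"
  have start: "p 0 = a" if "p \<in> SE_from k a" for p a using that by (simp add: SE_from_def)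
  show "p \<in> SE_from k ?a \<longleftrightarrow> p \<in> case_nat ?a ` SE_from k (lh_point n (Suc N)) \<union>
     (if N mod (n + 1) < n then case_nat ?a ` SE_from k (lh_west n N) else {})"
  proof
    assume p: "p \<in> SE_from k ?a"
    then have e: "p = case_nat ?a (\<lambda>m. p (Suc m))"
      using start by (auto simp: fun_eq_iff split: nat.split)
    with p SE_from_Cons[of ?a "\<lambda>m. p (Suc m)" k]
    have "(south_step (p 1) ?a \<or> east_step (p 1) ?a) \<and> (\<lambda>m. p (Suc m)) \<in> SE_from k (p 1)"
      by simp
    then show "p \<in> case_nat ?a ` SE_from k (lh_point n (Suc N)) \<union>
     (if N mod (n + 1) < n then case_nat ?a ` SE_from k (lh_west n N) else {})"
      unfolding south_step_point east_step_point using e by auto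
  next
    assume "p \<in> case_nat ?a ` SE_from k (lh_point n (Suc N)) \<union>
     (if N mod (n + 1) < n then case_nat ?a ` SE_from k (lh_west n N) else {})"
    then obtain p' where p': "p = case_nat ?a p'" "p' \<in> SE_from k (lh_point n (Suc N)) \<or>
       p' \<in> SE_from k (lh_west n N) \<and> N mod (n + 1) < n"
      by (auto split: if_splits)
    then have "p' 0 = lh_point n (Suc N) \<or> N mod (n + 1) < n \<and> p' 0 = lh_west n N"
      and "p' \<in> SE_from k (p' 0)"
      using start by metis+
    then show "p \<in> SE_from k ?a"
      unfolding p'(1) SE_from_Cons south_step_point east_step_point by blast
  qed
qed

section \<open>Weight sums for arbitrary end points and their recurrence\<close>

definition lh_from :: "'a::comm_semiring_1 weight_system \<Rightarrow> nat \<Rightarrow> nat \<Rightarrow> nat \<Rightarrow> 'a" where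
  "lh_from w k n N = fsum (path_weight w) (SE_from k (lh_point n N))"

lemma lh_h_eq: "lh_h w n k = lh_from w k n 0"
  by (simp add: lh_h_def lh_from_def SE_eq_SE_from)

text \<open>Followed backwards, the path only climbs as long as it makes south steps, so it stays in
  the region where every east step has weight 0; a single east step would annihilate the
  weight.\<close>

lemma vertical_path:
  assumes p: "p \<in> SE_from k (lh_point n N)" "path_weight w p \<noteq> 0" and N: "N \<ge> L * (n + 1)"
    and w: "\<And>t i j. t \<ge> L \<Longrightarrow> w t i j = 0"
  shows "p m = lh_point n (N + m)"
proof (induction m)
  case 0
  then show ?case using p by (simp add: SE_from_def)
next
  case (Suc m)
  have "L \<le> (N + m) div (n + 1)"
    using N by (subst less_eq_div_iff_mult_less_eq) auto
  then have "\<not> east_step (p (Suc m)) (p m)"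
    using path_weight_eq_0[OF p(1) Suc] p(2) w by blast
  then have "south_step (p (Suc m)) (p m)" using p(1) by (auto simp: SE_from_def)
  then show ?case by (simp add: Suc south_step_point)
qed

text \<open>Only the vertical path can have nonzero weight. Its first coordinate is constantly
  \<open>n\<close>, so it belongs to column \<open>k\<close> only for \<open>n = k\<close>, and then
  its weight is an empty product.\<close>

lemma lh_from_high:
  assumes N: "N \<ge> L * (n + 1)" and w: "\<And>t i j. t \<ge> L \<Longrightarrow> w t i j = 0"
  shows "finite {p \<in> SE_from k (lh_point n N). path_weight w p \<noteq> 0}"
    and "lh_from w k n N = (if n = k then 1 else 0)"
proof -
  let ?v = "\<lambda>m. lh_point n (N + m)"
  have sub: "{p \<in> SE_from k (lh_point n N). path_weight w p \<noteq> 0} \<subseteq> {?v}"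
    using vertical_path[where w = w and L = L, OF _ _ N w] by (auto simp: fun_eq_iff)
  then show "finite {p \<in> SE_from k (lh_point n N). path_weight w p \<noteq> 0}"
    by (rule finite_subset) simp
  have fst_v: "(\<lambda>m. fst (?v m)) = (\<lambda>m. real n)" by (simp add: lh_point_def)
  show "lh_from w k n N = (if n = k then 1 else 0)"
  proof (cases "n = k")
    case True
    have "filterlim (\<lambda>m. real (N + m) / (real n + 1)) at_top sequentially"
    proof (rule filterlim_at_top_mono)
      show "filterlim (\<lambda>m. inverse (real n + 1) * real m) at_top sequentially"
        by (rule filterlim_tendsto_pos_mult_at_top[OF tendsto_const])
          (simp_all add: filterlim_real_sequentially)
      show "\<forall>\<^sub>F m in sequentially. inverse (real n + 1) * real m \<le> real (N + m) / (real n + 1)"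
        by (simp add: field_simps)
    qed
    then have "filterlim (\<lambda>m. snd (?v m)) at_top sequentially"
      by (simp add: lh_point_def)
    moreover have "(\<lambda>m. fst (?v m)) \<longlonglongrightarrow> real k"
      using True by (simp add: lh_point_def)
    ultimately have v: "?v \<in> SE_from k (lh_point n N)"
      by (simp add: SE_from_def south_step_point)
    have "\<not> east_step (?v (Suc m)) (?v m)" for m
      by (cases n) (auto simp: east_step_point lh_west_def lh_point_inj)
    then have "east_indices ?v = {}"
      unfolding east_indices_def east_step_def by fastforce
    then have "path_weight w ?v = 1" by (simp add: path_weight_alt)
    moreover have "lh_from w k n N = (\<Sum>p\<in>{?v}. path_weight w p)"
      unfolding lh_from_def by (rule fsum_eq_sum) (use sub v in auto)
    ultimately show ?thesis using True by simp
  next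
    case False
    have "?v \<notin> SE_from k (lh_point n N)"
      using False by (auto simp: SE_from_def fst_v LIMSEQ_const_iff)
    then have "{p \<in> SE_from k (lh_point n N). path_weight w p \<noteq> 0} = {}" using sub by auto
    then show ?thesis using False unfolding lh_from_def fsum_def by simp
  qed
qed

text \<open>Needed for splitting \<open>fsum\<close>. Induction on the column, and inside it
  downwards from index \<open>L * (n + 1)\<close>: the support is contained in the images of the
  supports at the north and the west neighbour.\<close>

lemma finite_path_weight_support:
  fixes w :: "'a::comm_semiring_1 weight_system"
  assumes w: "\<And>t i j. t \<ge> L \<Longrightarrow> w t i j = 0"
  shows "finite {p \<in> SE_from k (lh_point n N). path_weight w p \<noteq> 0}"
proof (induction n arbitrary: N rule: less_induct)
  case (less n)
  show ?case
  proof (cases "N \<ge> L * (n + 1)")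
    case True
    then show ?thesis using lh_from_high(1)[where w = w and L = L, OF _ w] by blast
  next
    case False
    then have "N \<le> L * (n + 1)" by simp
    then show ?thesis
    proof (induction rule: inc_induct)
      case base
      show ?case using lh_from_high(1)[where w = w and L = L, OF order_refl w] by blast
    next
      case (step N)
      have south: "path_weight w (case_nat (lh_point n N) p) = path_weight w p"
        if "p \<in> SE_from k (lh_point n (Suc N))" for p
        by (rule path_weight_south) (use that in \<open>simp add: SE_from_def\<close>)
      have "{p \<in> SE_from k (lh_point n N). path_weight w p \<noteq> 0} \<subseteq>
        case_nat (lh_point n N) ` {p \<in> SE_from k (lh_point n (Suc N)). path_weight w p \<noteq> 0} \<union>
        (if N mod (n + 1) < n then case_nat (lh_point n N) `
          {p \<in> SE_from k (lh_west n N). path_weight w p \<noteq> 0} else {})"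
        unfolding SE_from_point[of k n N]
        by (auto simp: south path_weight_east split: if_splits)
      moreover have "finite {p \<in> SE_from k (lh_west n N). path_weight w p \<noteq> 0}"
        if "N mod (n + 1) < n"
        unfolding lh_west_def using less.IH[of "n - 1"] that by simp
      ultimately show ?case using step.IH
        by (elim finite_subset) auto
    qed
  qed
qed

text \<open>Paths are sorted by their last step; the two classes are disjoint because the remaining
  paths end at different points, and an east step contributes its weight as a factor.\<close>

lemma lh_from_rec:
  fixes w :: "'a::comm_semiring_1 weight_system"
  assumes w: "\<And>t i j. t \<ge> L \<Longrightarrow> w t i j = 0"
  shows "lh_from w k n N = lh_from w k n (Suc N) +
    (if N mod (n + 1) < n then w (N div (n + 1)) (n - 1) (N mod (n + 1)) *
       lh_from w k (n - 1) (N div (n + 1) * n + N mod (n + 1)) else 0)"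
proof -
  let ?c = "case_nat (lh_point n N) :: (nat \<Rightarrow> point) \<Rightarrow> nat \<Rightarrow> point"
  let ?S = "SE_from k (lh_point n (Suc N))" and ?W = "SE_from k (lh_west n N)"
  note fin = finite_path_weight_support[where w = w and L = L and k = k, OF w]
  have inj: "inj_on ?c A" for A
    by (rule inj_onI) (metis Nitpick.case_nat_unfold diff_Suc_1 ext nat.simps(5))
  have "path_weight w (?c p) = path_weight w p" if "p \<in> ?S" for p
    by (rule path_weight_south) (use that in \<open>simp add: SE_from_def\<close>)
  then have south: "fsum (path_weight w) (?c ` ?S) = lh_from w k n (Suc N)"
    unfolding fsum_image[OF inj] lh_from_def by (intro fsum_cong) simp
  show ?thesis
  proof (cases "N mod (n + 1) < n")
    case True
    have fW: "finite {p \<in> ?W. path_weight w p \<noteq> 0}"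
      unfolding lh_west_def by (rule fin)
    have "fsum (path_weight w) (?c ` ?W)
      = fsum (\<lambda>p. w (N div (n + 1)) (n - 1) (N mod (n + 1)) * path_weight w p) ?W"
      unfolding fsum_image[OF inj] by (rule fsum_cong) (simp add: path_weight_east[OF _ True])
    also have "\<dots> = w (N div (n + 1)) (n - 1) (N mod (n + 1)) *
       lh_from w k (n - 1) (N div (n + 1) * n + N mod (n + 1))"
      unfolding fsum_mult_left[OF fW] by (simp add: lh_from_def lh_west_def)
    finally have east: "fsum (path_weight w) (?c ` ?W) = \<dots>" .
    have un: "SE_from k (lh_point n N) = ?c ` ?S \<union> ?c ` ?W"
      unfolding SE_from_point[of k n N] using True by simp
    have "lh_west n N \<noteq> lh_point n (Suc N)"
      using True by (auto simp: lh_west_def lh_point_inj)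
    then have "?S \<inter> ?W = {}" by (auto simp: SE_from_def)
    then have "?c ` ?S \<inter> ?c ` ?W = {}"
      using inj_on_image_Int[OF inj, of ?S UNIV ?W] by simp
    moreover have "finite {p \<in> ?c ` ?S. path_weight w p \<noteq> 0}"
      "finite {p \<in> ?c ` ?W. path_weight w p \<noteq> 0}"
      using fin[of n N] unfolding un by (auto elim: finite_subset[rotated])
    ultimately have "lh_from w k n N
        = fsum (path_weight w) (?c ` ?S) + fsum (path_weight w) (?c ` ?W)"
      unfolding lh_from_def un by (rule fsum_Un_disjoint[rotated 2])
    then show ?thesis unfolding south east using True by simp
  next
    case False
    then have "SE_from k (lh_point n N) = ?c ` ?S" unfolding SE_from_point[of k n N] by simp
    then show ?thesis using False south by (simp add: lh_from_def)
  qed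
qed

text \<open>The same double induction, now through the recurrence: \<open>n = k\<close> fails at the
  top, and west neighbours lie in a smaller column. Sums over \<open>k \<le> n\<close> may thus be
  extended to larger bounds.\<close>

lemma lh_from_eq_0:
  fixes w :: "'a::comm_semiring_1 weight_system"
  assumes w: "\<And>t i j. t \<ge> L \<Longrightarrow> w t i j = 0" and "n < k"
  shows "lh_from w k n N = 0"
  using \<open>n < k\<close>
proof (induction n arbitrary: N rule: less_induct)
  case (less n)
  note high = lh_from_high(2)[where w = w and L = L, OF _ w]
  show ?case
  proof (cases "N \<ge> L * (n + 1)")
    case True
    then show ?thesis using high less.prems by simp
  next
    case False
    then have "N \<le> L * (n + 1)" by simp
    then show ?thesis
    proof (induction rule: inc_induct)
      case base
      show ?case using high[OF order_refl] less.prems by simp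
    next
      case (step N)
      then show ?case
        using less by (subst lh_from_rec[where w = w and L = L, OF w]) auto
    qed
  qed
qed

section \<open>The recurrence through unit strips\<close>

text \<open>For \<open>w\<close> of finite height, every \<open>lh_from w k\<close> satisfies this
  linear recurrence, hence so do linear combinations over \<open>k\<close>; the strips are then
  handled without paths.\<close>

locale lh_recurrence =
  fixes w :: "'a::comm_ring_1 weight_system" and V :: "nat \<Rightarrow> nat \<Rightarrow> 'a"
  assumes rec: "V n N = V n (Suc N) + (if N mod (n + 1) < n
    then w (N div (n + 1)) (n - 1) (N mod (n + 1)) * V (n - 1) (N div (n + 1) * n + N mod (n + 1))
    else 0)"
begin

text \<open>With the column written as \<open>Suc (j + i)\<close>, the offset \<open>j\<close> is
  below the column number, so an east step always arrives.\<close>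

lemma strip_step:
  "V (Suc (j + i)) (t * (Suc (j + i) + 1) + j)
    = V (Suc (j + i)) (t * (Suc (j + i) + 1) + Suc j) + w t (j + i) j * V (j + i) (t * (j + i + 1) + j)"
proof -
  have "(t * (Suc (j + i) + 1) + j) div (Suc (j + i) + 1) = t"
    "(t * (Suc (j + i) + 1) + j) mod (Suc (j + i) + 1) = j"
    by (simp_all only: div_mult_self3 mod_mult_self3) auto
  then show ?thesis
    by (subst rec) simp
qed

text \<open>At the last offset \<open>j = n\<close> no east step arrives, so the value at the bottom
  of the next strip is copied.\<close>

lemma strip_top: "V n (t * (n + 1) + n) = V n (Suc t * (n + 1))"
proof -
  have "(t * (n + 1) + n) mod (n + 1) = n"
    by (simp only: mod_mult_self3) simp
  then show ?thesis by (subst rec) (simp add: algebra_simps)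
qed

text \<open>In terms of \<open>j\<close> and the distance \<open>N\<close> from \<open>j\<close> to
  the column number, the north neighbour has \<open>Suc j\<close> with distance one less, and the
  west neighbour has the same \<open>j\<close> with distance one less. This is the recursion of
  \<open>qshift\<close>.\<close>

lemma strip_qshift:
  assumes w: "\<And>i j. w t (j + i) j = c * p ^ i"
  shows "V (j + N) (t * (j + N + 1) + j) = qshift p c (\<lambda>n. V n (Suc t * (n + 1))) N j"
proof (induction N arbitrary: j)
  case 0
  show ?case using strip_top[of j t] by simp
next
  case (Suc N)
  show ?case
    using Suc[of j] Suc[of "Suc j"] strip_step[of j N t] by (simp add: w)
qed

text \<open>If the weights depend on \<open>j\<close> only, the inductive step is
  \<open>x ^ N * P (Suc j) + a j * x ^ N * P j = x ^ Suc N * P j\<close>: the weight undoes the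
  subtraction in the factor \<open>x - a j\<close>.\<close>

lemma strip_power:
  assumes w: "\<And>i j. w t (j + i) j = a j"
    and P: "\<And>n. V n (Suc t * (n + 1)) = P n" "\<And>n. P (Suc n) = (x - a n) * P n"
  shows "V (j + N) (t * (j + N + 1) + j) = x ^ N * P j"
proof (induction N arbitrary: j)
  case 0
  show ?case using strip_top[of j t] P(1)[of j] by simp
next
  case (Suc N)
  show ?case
    using Suc[of j] Suc[of "Suc j"] strip_step[of j N t] w[of j N] by (simp add: P(2) algebra_simps)
qed

lemma qshift_strips:
  assumes V3: "\<And>n. V n (3 * (n + 1)) = H n" and H0: "H 0 = 1"
    and H: "\<And>n. H (Suc n) = x * H n - c\<^sup>2 * (1 - q ^ n) * H (n - 1)"
    and pq: "p * q = 1"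
    and w0: "\<And>i j. w 0 (j + i) j = - c * q ^ j - c * p ^ j"
    and w1: "\<And>i j. w 1 (j + i) j = c * p ^ i"
    and w2: "\<And>i j. w 2 (j + i) j = c * q ^ i"
  shows "V n 0 = x ^ n"
proof -
  have V2: "V n (2 * (n + 1)) = qshift q c H n 0" for n
    using strip_qshift[of 2 c q 0 n] w2 V3 by simp
  have Q: "qshift q c H (Suc n) 0 = (x + c * q ^ n) * qshift q c H n 0
      - c\<^sup>2 * (1 - q ^ n) * qshift q c H (n - 1) 0" for n
    by (rule qshift_three_term) (rule H)
  define P where "P = (\<lambda>n. qshift p c (\<lambda>n. qshift q c H n 0) n 0)"
  have V1: "V n (1 * (n + 1)) = P n" for n
  proof -
    have "V (0 + n) (1 * (0 + n + 1) + 0) = qshift p c (\<lambda>n. V n (Suc 1 * (n + 1))) n 0"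
      by (rule strip_qshift) (rule w1)
    then show ?thesis
      unfolding P_def V2[symmetric] by (simp add: numeral_2_eq_2)
  qed
  \<comment> \<open>The root contributed by the two upper strips is the weight of the bottom strip
    at \<open>j = n\<close>, as \<open>strip_power\<close> requires.\<close>
  have P: "P (Suc n) = (x - (- c * q ^ n - c * p ^ n)) * P n" for n
    unfolding P_def by (subst qshift_factor[OF Q pq]) (simp add: algebra_simps)
  have "V (0 + n) (0 * (0 + n + 1) + 0) = x ^ n * P 0"
    by (rule strip_power[OF w0 _ P]) (use V1 in simp)
  then show ?thesis
    by (simp add: P_def H0)
qed

end

section \<open>Continuous q-Hermite polynomials\<close>

lemma qpoch_Suc: "qpoch z q (Suc k) = qpoch z q k * (1 - z * q ^ k)"
  by (simp add: qpoch_def)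

text \<open>The quotient of consecutive coefficients of the series is
  \<open>(1 - q ^ (n - k)) / (1 - q ^ Suc k)\<close> for \<open>k \<le> n\<close>, the same as for
  the Gaussian binomials; \<open>q\<close> not being a root of unity keeps the denominators
  nonzero.\<close>

lemma phi20_qbinom:
  fixes q z :: "'a::field"
  assumes q: "q \<noteq> 0" "\<And>k. q ^ Suc k \<noteq> 1"
  shows "phi20 (q powi (- int n)) 0 q (q ^ n * z) = (\<Sum>k\<le>n. qbinom q n k * z ^ k)"
proof -
  have qp: "q powi (- int n) = inverse (q ^ n)"
    by (simp add: power_int_minus)
  have t: "qpoch (inverse (q ^ n)) q k / qpoch q q k * inverse ((-1) ^ k * q ^ (k choose 2))
      * (q ^ n) ^ k = qbinom q n k" for k
  proof (induction k)
    case 0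
    then show ?case by (simp add: qpoch_def numeral_2_eq_2)
  next
    case (Suc k)
    have ch: "Suc k choose 2 = k + (k choose 2)"
      by (simp add: numeral_2_eq_2)
    \<comment> \<open>The factor \<open>qbinom q n k\<close> is kept on both sides: for
      \<open>k > n\<close> it vanishes, which covers the truncated exponent
      \<open>n - k\<close>.\<close>
    have r: "(1 - inverse (q ^ n) * q ^ k) * inverse (- (q ^ k)) * q ^ n * qbinom q n k
        = (1 - q ^ (n - k)) * qbinom q n k"
    proof (cases "k \<le> n")
      case True
      then obtain d where "n = k + d" using le_Suc_ex by blast
      then show ?thesis using q(1) by (simp add: power_add field_simps)
    qed (simp add: qbinom_eq_0)
    have "qpoch (inverse (q ^ n)) q (Suc k) / qpoch q q (Suc k)
        * inverse ((-1) ^ Suc k * q ^ (Suc k choose 2)) * (q ^ n) ^ Suc k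
      = (qpoch (inverse (q ^ n)) q k / qpoch q q k * inverse ((-1) ^ k * q ^ (k choose 2))
        * (q ^ n) ^ k) * ((1 - inverse (q ^ n) * q ^ k) * inverse (- (q ^ k)) * q ^ n)
        / (1 - q ^ Suc k)"
      by (simp add: qpoch_Suc ch power_add divide_inverse mult_ac)
    also have "\<dots> = (1 - q ^ Suc k) * qbinom q n (Suc k) / (1 - q ^ Suc k)"
      unfolding Suc.IH qbinom_step r[symmetric] by (simp only: mult_ac)
    also have "\<dots> = qbinom q n (Suc k)"
      using q(2)[of k] by simp
    finally show ?case .
  qed
  have "phi20 (q powi (- int n)) 0 q (q ^ n * z) = fsum (\<lambda>k. qbinom q n k * z ^ k) UNIV"
    unfolding phi20_def qp t[symmetric]
    by (rule fsum_cong) (simp add: qpoch_def power_mult_distrib mult_ac)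
  also have "\<dots> = (\<Sum>k\<le>n. qbinom q n k * z ^ k)"
  proof (rule fsum_eq_sum)
    show "{k \<in> UNIV. qbinom q n k * z ^ k \<noteq> 0} \<subseteq> {..n}"
      by (intro subsetI, rule ccontr) (simp add: qbinom_eq_0)
  qed simp_all
  finally show ?thesis .
qed

section \<open>The coefficient field of rational functions in q\<close>

lemma Cconst_simps:
  "Cconst (a + b) = Cconst a + Cconst b" "Cconst (a * b) = Cconst a * Cconst b"
  "Cconst (a ^ n) = Cconst a ^ n" "Cconst 1 = 1" "Cconst a = Cconst b \<longleftrightarrow> a = b"
proof -
  show m: "Cconst (a * b) = Cconst a * Cconst b" for a b
    by (simp add: Cconst_def flip: to_fract_mult)
  show o: "Cconst 1 = 1"
    by (simp add: Cconst_def flip: one_pCons)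
  show "Cconst (a ^ n) = Cconst a ^ n"
    by (induction n) (simp_all add: m o)
qed (simp_all add: Cconst_def flip: to_fract_add)

lemma Cq_two_neq_0: "(2::Cq) \<noteq> 0"
  using Cconst_simps(1)[of 1 1] Cconst_simps(5)[of 2 0]
  by (simp add: Cconst_simps(4)) (simp add: Cconst_def)

lemma qvar_power: "qvar ^ k = to_fract ([:0, 1:] ^ k)"
  by (induction k) (simp_all add: qvar_def flip: to_fract_mult)

lemma qvar_neq_0: "qvar \<noteq> 0"
  by (simp add: qvar_def)

lemma qvar_power_neq_1: "qvar ^ Suc k \<noteq> 1"
proof
  assume "qvar ^ Suc k = 1"
  then have "[:0, 1:] ^ Suc k = (1 :: complex poly)"
    unfolding qvar_power by (simp only: to_fract_1[symmetric] to_fract_eq_iff)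
  then have "poly ([:0, 1:] ^ Suc k) 0 = poly (1 :: complex poly) 0" by simp
  then show False by (simp add: poly_power)
qed

text \<open>The values \<open>cos \<theta>\<close> fill an interval, which embeds into
  \<open>Cq\<close> as an infinite set, while a nonzero polynomial has finitely many roots.\<close>

lemma Cq_poly_eqI:
  fixes P Q :: "Cq poly"
  assumes "\<And>\<theta>::real. poly P (Cconst (of_real (cos \<theta>))) = poly Q (Cconst (of_real (cos \<theta>)))"
  shows "P = Q"
proof (rule ccontr)
  assume "P \<noteq> Q"
  then have "finite {x. poly (P - Q) x = 0}" by (intro poly_roots_finite) simp
  moreover have "poly P (Cconst (of_real r)) = poly Q (Cconst (of_real r))"
    if "r \<in> {-1..1}" for r
    using assms[of "arccos r"] that by simp
  then have "(\<lambda>r. Cconst (of_real r)) ` {-1..1::real} \<subseteq> {x. poly (P - Q) x = 0}"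
    by auto
  ultimately have "finite ((\<lambda>r. Cconst (of_real r)) ` {-1..1::real})"
    by (rule finite_subset[rotated])
  moreover have "inj_on (\<lambda>r. Cconst (of_real r)) {-1..1::real}"
    by (auto simp: inj_on_def Cconst_simps)
  ultimately have "finite {-1..1::real}" by (simp add: finite_image_iff)
  then show False using infinite_Icc[of "-1::real" 1] by simp
qed

section \<open>Three-term recurrence of the continuous q-Hermite polynomials\<close>

fun qHermite_rec :: "nat \<Rightarrow> Cq poly" where
  "qHermite_rec 0 = 1"
| "qHermite_rec (Suc 0) = [:0, 1:]"
| "qHermite_rec (Suc (Suc n)) =
     [:0, 1:] * qHermite_rec (Suc n) - smult ((1 - qvar ^ Suc n) / 4) (qHermite_rec n)"

lemma qHermite_rec_monic: "degree (qHermite_rec n) \<le> n \<and> coeff (qHermite_rec n) n = 1"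
proof (induction n rule: qHermite_rec.induct)
  case (3 n)
  then have "degree ([:0, 1:] * qHermite_rec (Suc n)) \<le> Suc (Suc n)"
    by (intro order_trans[OF degree_mult_le]) simp
  moreover have "degree (smult ((1 - qvar ^ Suc n) / 4) (qHermite_rec n)) \<le> Suc (Suc n)"
    using 3 by (intro order_trans[OF degree_smult_le]) simp
  ultimately have "degree (qHermite_rec (Suc (Suc n))) \<le> Suc (Suc n)"
    unfolding qHermite_rec.simps by (rule degree_diff_le)
  moreover have "coeff (qHermite_rec n) (Suc (Suc n)) = 0"
    using 3 by (intro coeff_eq_0) auto
  ultimately show ?case using 3 by simp
qed simp_all

text \<open>Both sides satisfy the same recurrence, by \<open>rogers_szego_rec\<close> with
  \<open>u * v = 1\<close>; the scaling by \<open>2 ^ n\<close> accounts for the 4 in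
  \<open>qHermite_rec\<close>.\<close>

lemma poly_qHermite_rec:
  fixes u v :: Cq
  assumes "u * v = 1"
  shows "poly (qHermite_rec n) ((u + v) / 2)
    = (\<Sum>k\<le>n. qbinom qvar n k * u ^ (n - k) * v ^ k) / 2 ^ n"
proof (induction n rule: qHermite_rec.induct)
  case (3 n)
  have "(u + v) / t * (r / t ^ Suc n) - e / (t * t) * (s / t ^ n)
      = ((u + v) * r - e * 1 * s) / t ^ Suc (Suc n)" if "t \<noteq> 0" for r s e t :: Cq
    using that by (simp add: field_simps)
  from this[of 2, OF Cq_two_neq_0] have "(u + v) / 2 * (r / 2 ^ Suc n) - e / 4 * (s / 2 ^ n)
      = ((u + v) * r - e * 1 * s) / 2 ^ Suc (Suc n)" for r s e :: Cq
    by (simp only: arith_simps)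
  then show ?case
    unfolding rogers_szego_rec assms qHermite_rec.simps
    by (simp only: poly_diff poly_mult poly_smult poly_pCons poly_0 3) simp
qed simp_all

text \<open>With \<open>u\<close> and \<open>v\<close> the images of
  \<open>exp (\<i> * \<theta>)\<close> and its inverse, the series has argument
  \<open>qvar ^ n * v ^ 2\<close>, and \<open>u * v = 1\<close> turns the formula into a
  Rogers-Szego polynomial. Uniqueness is \<open>Cq_poly_eqI\<close>.\<close>

lemma qHermite_eq_rec: "qHermite n = qHermite_rec n"
proof -
  have *: "poly (qHermite_rec n) (Cconst (of_real (cos \<theta>))) =
       Cconst (exp (\<i> * of_nat n * of_real \<theta>)) / 2 ^ n
       * phi20 (qvar powi (- int n)) 0 qvar
           (qvar ^ n * Cconst (exp (- 2 * \<i> * of_real \<theta>)))" for \<theta> :: real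
  proof -
    define u where "u = Cconst (exp (\<i> * of_real \<theta>))"
    define v where "v = Cconst (exp (- (\<i> * of_real \<theta>)))"
    have uv: "u * v = 1"
      unfolding u_def v_def Cconst_simps(2)[symmetric] exp_minus_inverse by (rule Cconst_simps(4))
    have "2 * Cconst (of_real (cos \<theta>)) = Cconst (2 * of_real (cos \<theta>))"
      by (simp only: mult_2 Cconst_simps(1))
    also have "\<dots> = u + v"
      unfolding u_def v_def Cconst_simps(1)[symmetric]
      by (intro arg_cong[of _ _ Cconst]) (simp add: complex_eq_iff Re_exp Im_exp)
    finally have c: "Cconst (of_real (cos \<theta>)) = (u + v) / 2"
      using Cq_two_neq_0 by (simp add: field_simps)
    have un: "Cconst (exp (\<i> * of_nat n * of_real \<theta>)) = u ^ n"
      unfolding u_def Cconst_simps(3)[symmetric] exp_of_nat_mult[symmetric] by (simp add: mult_ac)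
    have v2: "Cconst (exp (- 2 * \<i> * of_real \<theta>)) = v ^ 2"
      unfolding v_def Cconst_simps(3)[symmetric] exp_of_nat_mult[symmetric] by (simp add: mult_ac)
    have "u ^ n * (v ^ 2) ^ k = u ^ (n - k) * v ^ k" if k: "k \<le> n" for k
    proof -
      obtain d where "n = k + d" using le_Suc_ex[OF k] by blast
      then have "u ^ n * (v ^ 2) ^ k = u ^ (n - k) * v ^ k * (u * v) ^ k"
        by (simp add: power_add power_mult_distrib power2_eq_square mult_ac)
      then show ?thesis by (simp add: uv)
    qed
    then have "u ^ n * (\<Sum>k\<le>n. qbinom qvar n k * (v ^ 2) ^ k)
        = (\<Sum>k\<le>n. qbinom qvar n k * u ^ (n - k) * v ^ k)"
      unfolding sum_distrib_left by (intro sum.cong) (simp_all add: mult_ac)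
    then show ?thesis
      unfolding c un v2 phi20_qbinom[OF qvar_neq_0 qvar_power_neq_1] poly_qHermite_rec[OF uv]
      by simp
  qed
  show ?thesis
    unfolding qHermite_def
  proof (rule the_equality)
    fix P :: "Cq poly"
    assume "\<forall>\<theta>::real. poly P (Cconst (of_real (cos \<theta>))) =
       Cconst (exp (\<i> * of_nat n * of_real \<theta>)) / 2 ^ n
       * phi20 (qvar powi (- int n)) 0 qvar
           (qvar ^ n * Cconst (exp (- 2 * \<i> * of_real \<theta>)))"
    then show "P = qHermite_rec n"
      by (intro Cq_poly_eqI) (simp only: *)
  qed (intro allI *)
qed

section \<open>Uniqueness of the mixed moments\<close>

lemma monic_family_independent:
  fixes H :: "nat \<Rightarrow> 'a::comm_ring_1 poly"
  assumes H: "\<And>n. degree (H n) \<le> n" "\<And>n. coeff (H n) n = 1"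
    and s: "(\<Sum>k\<le>n. smult (c k) (H k)) = 0" and k: "k \<le> n"
  shows "c k = 0"
  using s k
proof (induction n)
  case 0
  then have "coeff (smult (c 0) (H 0)) 0 = 0" by simp
  then show ?case using H(2)[of 0] 0 by simp
next
  case (Suc n)
  \<comment> \<open>Only \<open>H (Suc n)\<close> reaches degree \<open>Suc n\<close>, so the
    leading coefficient of the sum isolates \<open>c (Suc n)\<close>.\<close>
  have "coeff (H k) (Suc n) = 0" if "k \<le> n" for k
    using H(1)[of k] that by (intro coeff_eq_0) auto
  then have "coeff (\<Sum>k\<le>n. smult (c k) (H k)) (Suc n) = 0"
    by (simp add: coeff_sum)
  then have "coeff (\<Sum>k\<le>Suc n. smult (c k) (H k)) (Suc n) = c (Suc n)"
    by (simp add: H)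
  then have "c (Suc n) = 0" unfolding Suc.prems(1) by simp
  then show ?case using Suc by (cases "k = Suc n") auto
qed

text \<open>The difference of two expansions of the same monomial is a vanishing combination of
  monic polynomials of distinct degrees; exhibiting one expansion therefore determines
  \<open>sigmaH\<close>.\<close>

lemma sigmaH_eqI:
  assumes s0: "\<And>n k. n < k \<Longrightarrow> s n k = 0"
    and s: "\<And>n. monom 1 n = (\<Sum>k\<le>n. smult (s n k) (qHermite k))"
  shows "sigmaH = s"
  unfolding sigmaH_def
proof (rule the_equality)
  fix s'
  assume s': "(\<forall>n k. n < k \<longrightarrow> s' n k = 0) \<and>
    (\<forall>n. monom 1 n = (\<Sum>k\<le>n. smult (s' n k) (qHermite k)))"
  show "s' = s"
  proof (intro ext)
    fix n k
    show "s' n k = s n k"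
    proof (cases "k \<le> n")
      case True
      have "(\<Sum>i\<le>n. smult (s' n i) (qHermite i)) = (\<Sum>i\<le>n. smult (s n i) (qHermite i))"
        using s s' by metis
      then have "(\<Sum>i\<le>n. smult (s' n i - s n i) (qHermite i)) = 0"
        by (simp add: smult_diff_left sum_subtractf)
      then have "s' n k - s n k = 0"
        by (rule monic_family_independent[rotated 2])
          (use True qHermite_rec_monic in \<open>auto simp: qHermite_eq_rec\<close>)
      then show ?thesis by simp
    qed (use s0 s' in auto)
  qed
qed (use assms in auto)

theorem proposition5p6:
  fixes n k :: nat
  assumes "k \<le> n"
  shows "sigmaH n k = lh_h wH n k"
proof -
  have w3: "wH t i j = 0" if "t \<ge> 3" for t i j
    using that by (simp add: wH_def)
  note zero = lh_from_eq_0[where w = wH and L = 3, OF w3]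
  have "sigmaH = (\<lambda>n k. lh_from wH k n 0)"
  proof (rule sigmaH_eqI)
    fix n
    show "monom 1 n = (\<Sum>k\<le>n. smult (lh_from wH k n 0) (qHermite k))"
    \<comment> \<open>Evaluation at \<open>cos \<theta>\<close> turns the families of polynomials
      into scalar sequences, to which the strip lemmas apply.\<close>
    proof (rule Cq_poly_eqI)
      fix \<theta> :: real
      let ?x = "Cconst (of_real (cos \<theta>))"
      define H where "H = (\<lambda>k. poly (qHermite_rec k) ?x)"
      define V where "V = (\<lambda>n N. \<Sum>k\<le>n. lh_from wH k n N * H k)"
      \<comment> \<open>A common summation range for \<open>V n\<close> and \<open>V (n - 1)\<close>
        is needed to add up the recurrences over \<open>k\<close>.\<close>
      have V: "V n N = (\<Sum>k\<le>M. lh_from wH k n N * H k)" if "n \<le> M" for n N M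
        unfolding V_def by (rule sum.mono_neutral_left) (use that zero in auto)
      interpret lh_recurrence wH V
      proof
        fix n N
        show "V n N = V n (Suc N) + (if N mod (n + 1) < n
          then wH (N div (n + 1)) (n - 1) (N mod (n + 1)) *
            V (n - 1) (N div (n + 1) * n + N mod (n + 1)) else 0)"
          unfolding V[OF order_refl, of n] V[OF diff_le_self, of n 1]
          by (subst lh_from_rec[where w = wH and L = 3, OF w3])
            (cases "N mod (n + 1) < n",
              simp_all add: sum.distrib sum_distrib_left algebra_simps)
      qed
      have "V n 0 = ?x ^ n"
      \<comment> \<open>\<open>c = - 1 / 2\<close> is the constant factor of the weights in strips 1
        and 2; its square is the 1/4 of the q-Hermite recurrence, and
        \<open>- c * q ^ j - c * p ^ j\<close> is the weight in strip 0.\<close>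
      proof (rule qshift_strips[where H = H and c = "- 1 / 2" and q = qvar and p = "inverse qvar"])
        show "V n (3 * (n + 1)) = H n" for n
          unfolding V_def
          by (subst lh_from_high(2)[where w = wH and L = 3, OF order_refl w3])
            (simp_all add: if_distrib[of "\<lambda>a. a * _"] cong: if_cong)
        show "H 0 = 1" by (simp add: H_def)
        show "H (Suc n) = ?x * H n - (- 1 / 2)\<^sup>2 * (1 - qvar ^ n) * H (n - 1)" for n
          by (cases n) (simp_all add: H_def power2_eq_square)
        show "inverse qvar * qvar = 1" using qvar_neq_0 by simp
        show "wH 0 (j + i) j = - (- 1 / 2) * qvar ^ j - (- 1 / 2) * inverse qvar ^ j" for i j
          by (simp add: wH_def power_int_minus power_inverse add_divide_distrib)
        show "wH 1 (j + i) j = - 1 / 2 * inverse qvar ^ i" for i j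
          by (simp add: wH_def power_int_minus power_inverse)
        show "wH 2 (j + i) j = - 1 / 2 * qvar ^ i" for i j
          by (simp add: wH_def)
      qed
      then show "poly (monom 1 n) ?x = poly (\<Sum>k\<le>n. smult (lh_from wH k n 0) (qHermite k)) ?x"
        by (simp add: poly_monom poly_sum V_def H_def qHermite_eq_rec)
    qed
  qed (rule zero)
  then show ?thesis unfolding lh_h_eq by (rule fun_cong[THEN fun_cong])
qed

end
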